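(* For any game with activeness $G^g$ and any $b\in\{0,1\}$, $o(G^g+G^g+\emptyset^b)=\mathscr{P}$.
   Context: Let $\mathcal{B}=\{0,1\}$. Define $\mathbb{I}_0=\{\emptyset\}\times\mathcal{B}$ and $\mathbb{I}_n=2^{\mathbb{I}_{n-1}}\times\mathcal{B}$ for $n\ge1$; a game with activeness is an element of $\mathbb{I}=\bigcup_{n\ge0}\mathbb{I}_n$. A pair $(G,g)$ is written $G^g$; elements of $G$ are its options, $g=1$ meaning active. The outcome $o$ is defined recursively: $o(G^g)=\mathscr{N}$ if $g=1$ and some option has outcome $\mathscr{P}$, and $o(G^g)=\mathscr{P}$ otherwise. The sum is $G^g+H^h=(\{G'^{g'}+H^h:G'^{g'}\in G^g\}\cup\{G^g+H'^{h'}:H'^{h'}\in H^h\})^{\max\{g,h\}}$; it is associative. *)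

theory Defs
  imports Main "HOL-Library.FSet"
begin

text \<open>
  A game with activeness \<open>G\<^sup>g\<close> is \<open>Game G g\<close>, where \<open>True\<close> stands for 1 (active) and \<open>False\<close> for 0.
  Every level of the hierarchy is finite, so the set of options of a game is a finite set, and
  the union of all levels is the whole datatype (lemma \<open>UN_level\<close>).
\<close>

datatype game = Game (options: "game fset") (active: bool)

fun level :: "nat \<Rightarrow> game set" where
  "level 0 = {Game {||} g | g. True}"
| "level (Suc n) = {Game G g | G g. fset G \<subseteq> level n}"

lemma level_Suc_mono: "level n \<subseteq> level (Suc n)"
  by (induction n) auto

lemma level_mono: "m \<le> n \<Longrightarrow> level m \<subseteq> level n"
  using lift_Suc_mono_le[of level] level_Suc_mono by blast

lemma UN_level: "(\<Union>n. level n) = UNIV"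
proof -
  have "\<exists>n. x \<in> level n" for x
  proof (induction x)
    case (Game G g)
    then obtain f where f: "\<And>y. y \<in> fset G \<Longrightarrow> y \<in> level (f y)" by metis
    have "fset G \<subseteq> level (Max (f ` fset G))"
    proof
      fix y assume y: "y \<in> fset G"
      then have "f y \<le> Max (f ` fset G)" by simp
      then show "y \<in> level (Max (f ` fset G))" using f[OF y] level_mono by blast
    qed
    then have "Game G g \<in> level (Suc (Max (f ` fset G)))" by simp
    then show ?case by blast
  qed
  then show ?thesis by blast
qed

datatype outcome_class = \<N> | \<P>

primrec outcome :: "game \<Rightarrow> outcome_class" where
  "outcome (Game G g) = (if g \<and> \<P> |\<in>| outcome |`| G then \<N> else \<P>)"

lemma outcome_eq_N_iff: "outcome X = \<N> \<longleftrightarrow> active X \<and> (\<exists>X' \<in> fset (options X). outcome X' = \<P>)"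
  by (cases X) force

lemma size_option:
  assumes "X |\<in>| G"
  shows "size X < size (Game G g)"
proof -
  have "Suc (size X) \<le> (\<Sum>Y\<in>fset G. Suc (size Y))"
    using assms by (intro member_le_sum) auto
  then show ?thesis by (simp add: size_fset_overloaded_simps)
qed

function game_sum :: "game \<Rightarrow> game \<Rightarrow> game" (infixl "\<oplus>" 65) where
  "Game G g \<oplus> Game H h =
     Game ((\<lambda>X. X \<oplus> Game H h) |`| G |\<union>| (\<lambda>Y. Game G g \<oplus> Y) |`| H) (max g h)"
  by pat_completeness auto
termination
  by (relation "measure (\<lambda>(X, Y). size X + size Y)") (use size_option in \<open>simp_all del: game.size\<close>)

lemma game_sum_assoc: "(X \<oplus> Y) \<oplus> Z = X \<oplus> (Y \<oplus> Z)"
proof (induction "size X + size Y + size Z" arbitrary: X Y Z rule: less_induct)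
  case less
  obtain G g H h K k where eq: "X = Game G g" "Y = Game H h" "Z = Game K k"
    by (metis game.exhaust)
  have "(X' \<oplus> Y) \<oplus> Z = X' \<oplus> (Y \<oplus> Z)" if "X' |\<in>| G" for X'
    using less[of X' Y Z] size_option[OF that, of g] eq by simp
  moreover have "(X \<oplus> Y') \<oplus> Z = X \<oplus> (Y' \<oplus> Z)" if "Y' |\<in>| H" for Y'
    using less[of X Y' Z] size_option[OF that, of h] eq by simp
  moreover have "(X \<oplus> Y) \<oplus> Z' = X \<oplus> (Y \<oplus> Z')" if "Z' |\<in>| K" for Z'
    using less[of X Y Z'] size_option[OF that, of k] eq by simp
  ultimately show ?case
    unfolding eq
    by (simp add: fimage_funion fimage_fimage funion_assoc max.assoc cong: fset.map_cong)
qed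

end

theory Submission imports Defs begin

text \<open>
  The second player answers every move in one copy of \<open>G\<^sup>g\<close> by the same move in the other copy.
  This reply is always available: if the sum is active, then \<open>g = 1\<close> or \<open>b = 1\<close>, and both the
  summand \<open>\<emptyset>\<^sup>b\<close> and the untouched copy of \<open>G\<^sup>g\<close> are still present after the first move.
\<close>

lemma active_game_sum: "active (X \<oplus> Y) \<longleftrightarrow> active X \<or> active Y"
  by (cases X; cases Y) (auto simp: max_def)

lemma options_game_sum:
  "fset (options (X \<oplus> Y)) =
     (\<lambda>X'. X' \<oplus> Y) ` fset (options X) \<union> (\<lambda>Y'. X \<oplus> Y') ` fset (options Y)"
  by (cases X; cases Y) simp

text \<open>A move and its mirrored reply lead to \<open>X' \<oplus> X' \<oplus> Z\<close> for an
  option \<open>X'\<close> of \<open>X\<close>, so structural induction on \<open>X\<close> with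
  \<open>Z\<close> fixed suffices.\<close>

lemma outcome_double_sum:
  assumes "options Z = {||}"
  shows "outcome (X \<oplus> X \<oplus> Z) = \<P>"
proof (induction X)
  case (Game G g)
  let ?X = "Game G g"
  have IH: "outcome (X' \<oplus> X' \<oplus> Z) = \<P>" if "X' \<in> fset G" for X'
    using Game that by simp
  show ?case
  proof (rule ccontr)
    assume "outcome (?X \<oplus> ?X \<oplus> Z) \<noteq> \<P>"
    then have "outcome (?X \<oplus> ?X \<oplus> Z) = \<N>"
      by (metis outcome_class.exhaust)
    then obtain W where act: "active ?X \<or> active Z" and W: "outcome W = \<P>"
      and "W \<in> fset (options (?X \<oplus> ?X \<oplus> Z))"
      unfolding outcome_eq_N_iff[of "?X \<oplus> ?X \<oplus> Z"] active_game_sum by blast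
    \<comment> \<open>As \<open>Z\<close> has no options, the first move is in a copy of
      \<open>?X\<close>.\<close>
    then obtain X' where X': "X' \<in> fset G"
      and W_cases: "W = X' \<oplus> ?X \<oplus> Z \<or> W = ?X \<oplus> X' \<oplus> Z"
      using assms by (auto simp: options_game_sum simp del: game_sum.simps)
    \<comment> \<open>\<open>X'\<close> may be inactive, but \<open>W\<close> still contains
      \<open>?X\<close> and \<open>Z\<close>, one of which is active by \<open>act\<close>.\<close>
    have "active W"
      using W_cases act by (auto simp: active_game_sum simp del: game_sum.simps)
    \<comment> \<open>The reply moves the remaining \<open>?X\<close> to the same
      \<open>X'\<close>.\<close>
    moreover have "X' \<oplus> X' \<oplus> Z \<in> fset (options W)"
      using W_cases X' by (auto simp: options_game_sum simp del: game_sum.simps)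
    ultimately have "outcome W = \<N>"
      using IH[OF X'] outcome_eq_N_iff by blast
    with W show False by simp
  qed
qed

theorem theorem3p12:
  fixes G :: "game fset" and g b :: bool
  shows "outcome (Game G g \<oplus> Game G g \<oplus> Game {||} b) = \<P>"
  by (simp add: outcome_double_sum del: game_sum.simps)

end
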